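(* For every integer $n\geq 8$, $$\left\lceil\frac{7n}{4}\right\rceil\leq f(n)\leq 2n-2,$$ where $f(n)$ is the minimum number of edges of an edge-pancyclic graph with $n$ vertices and at least one edge.
   Context: All graphs are finite and simple. A graph $G$ with $n$ vertices is edge-pancyclic if, for every integer $k$ with $3\leq k\leq n$, every edge of $G$ lies in a cycle of $G$ of length $k$. *)

theory Defs
  imports Complex_Main
begin

type_synonym 'a edge = "'a set"

definition simple_graph :: "'a set \<Rightarrow> 'a edge set \<Rightarrow> bool" where
  "simple_graph V E \<longleftrightarrow> finite V \<and> (\<forall>e\<in>E. e \<subseteq> V \<and> card e = 2)"

(* A cycle is given by the cyclic sequence of its vertices. *)
definition cycle_edges :: "'a list \<Rightarrow> 'a edge set" where
  "cycle_edges vs = {{vs ! i, vs ! (Suc i mod length vs)} | i. i < length vs}"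

definition is_cycle :: "'a set \<Rightarrow> 'a edge set \<Rightarrow> 'a list \<Rightarrow> bool" where
  "is_cycle V E vs \<longleftrightarrow>
     3 \<le> length vs \<and> distinct vs \<and> set vs \<subseteq> V \<and> cycle_edges vs \<subseteq> E"

definition edge_pancyclic :: "'a set \<Rightarrow> 'a edge set \<Rightarrow> bool" where
  "edge_pancyclic V E \<longleftrightarrow>
     (\<forall>k. 3 \<le> k \<and> k \<le> card V \<longrightarrow>
        (\<forall>e\<in>E. \<exists>vs. is_cycle V E vs \<and> length vs = k \<and> e \<in> cycle_edges vs))"

(* Every finite graph is isomorphic to one whose vertices are natural numbers, so nothing is
   lost by fixing the vertex type. Complete graphs show that for n >= 2 the minimum is over a
   nonempty set. *)
definition min_edges_edge_pancyclic :: "nat \<Rightarrow> nat" where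
  "min_edges_edge_pancyclic n =
     (LEAST m. \<exists>(V :: nat set) E. simple_graph V E \<and> card V = n \<and> E \<noteq> {} \<and>
        edge_pancyclic V E \<and> card E = m)"

end

theory Submission
  imports Defs
begin

text \<open>
  Upper bound. In a wheel with \<open>n - 1\<close> rim vertices, the hub together with \<open>k - 1\<close> consecutive rim
  vertices forms a cycle of length \<open>k\<close>. Choosing where the rim path starts puts any prescribed edge
  on such a cycle, and a wheel has \<open>2 n - 2\<close> edges.

  Lower bound. The claim is that the average degree is at least \<open>7/2\<close>, and it is proved by
  discharging. All degrees are at least 3 (\<open>deg_ge_3\<close>): the two neighbours of a vertex of degree 2 are
  adjacent because of a triangle, but the edge between them lies on no Hamilton cycle. Give a vertex
  of degree \<open>d\<close> the charge \<open>4 d - 14\<close>. Only the small vertices, those of degree 3, are in debt, by 2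
  each. A small vertex collects 1 from each big neighbour, or 2 if it has only one big neighbour.

  Small vertices receive enough because each has a big neighbour. This comes from the local structure
  around two adjacent small vertices (\<open>adjacent_small\<close>): their common neighbour \<open>w\<close> is also adjacent
  to the third neighbour of each of them, and these two are distinct, so that \<open>w\<close> has degree at
  least 4. Hence the small vertices that depend on \<open>w\<close> alone lie on a fan around \<open>w\<close>.

  A big vertex \<open>w\<close> of degree \<open>d\<close> can pay (\<open>demand_bound\<close>). If \<open>d \<ge> 7\<close> it could give 2 to every
  neighbour. For \<open>d = 4, 5, 6\<close> an excessive demand would force a fan to close up around \<open>w\<close>, making
  the graph a wheel with at most 7 vertices, or to be attached to the rest through a single vertex
  only, which a Hamiltonian graph does not allow; for \<open>d = 4\<close> there is one further configuration, in
  which three pairwise nonadjacent small neighbours of \<open>w\<close> share a second common neighbour, and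
  counting the edges of a Hamilton cycle excludes it.
\<close>

section \<open>Edges of a cycle\<close>

lemma cycle_edges_image:
  "cycle_edges vs = (\<lambda>i. {vs ! i, vs ! (Suc i mod length vs)}) ` {..<length vs}"
  by (simp add: cycle_edges_def image_def lessThan_def) blast

lemma cycle_edges_three: "cycle_edges [a, b, c] = {{a, b}, {b, c}, {c, a}}"
  by (simp add: cycle_edges_image lessThan_Suc insert_commute)

lemma cycle_edges_four: "cycle_edges [a, b, c, d] = {{a, b}, {b, c}, {c, d}, {d, a}}"
  by (simp add: cycle_edges_image lessThan_Suc insert_commute)

lemma card_cycle_neighbours:
  assumes "distinct vs" "3 \<le> length vs" "v \<in> set vs"
  shows "card {u. {v, u} \<in> cycle_edges vs} = 2"
proof -
  let ?n = "length vs"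
  obtain i where i: "i < ?n" "v = vs ! i"
    using assms(3) by (metis in_set_conv_nth)
  define s where "s = Suc i mod ?n"
  define p where "p = (if i = 0 then ?n - 1 else i - 1)"
  have s: "s < ?n" "s \<noteq> i" and p: "p < ?n" "p \<noteq> i" "Suc p mod ?n = i"
    using i assms(2) by (auto simp: s_def p_def mod_Suc)
  have "s \<noteq> p"
    using i assms(2) by (auto simp: s_def p_def mod_Suc split: if_splits)
  have succ_eq: "j = p" if "j < ?n" "Suc j mod ?n = i" for j
    using that i assms(2) by (auto simp: p_def mod_Suc split: if_splits)
  have "{u. {v, u} \<in> cycle_edges vs} = {vs ! s, vs ! p}"
  proof (intro equalityI subsetI)
    fix u assume "u \<in> {u. {v, u} \<in> cycle_edges vs}"
    then obtain j where j: "j < ?n" "{v, u} = {vs ! j, vs ! (Suc j mod ?n)}"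
      by (auto simp: cycle_edges_def)
    have less: "Suc j mod ?n < ?n" using j(1) by (intro mod_less_divisor) auto
    consider "v = vs ! j" "u = vs ! (Suc j mod ?n)" | "v = vs ! (Suc j mod ?n)" "u = vs ! j"
      using j(2) by (metis doubleton_eq_iff)
    then show "u \<in> {vs ! s, vs ! p}"
    proof cases
      case 1
      then have "j = i" using i j(1) assms(1) by (metis nth_eq_iff_index_eq)
      then show ?thesis using 1 by (simp add: s_def)
    next
      case 2
      then have "Suc j mod ?n = i" using i less assms(1) by (metis nth_eq_iff_index_eq)
      then show ?thesis using 2 succ_eq j(1) by blast
    qed
  next
    fix u assume "u \<in> {vs ! s, vs ! p}"
    moreover have "{v, vs ! s} \<in> cycle_edges vs"
      using i by (auto simp: cycle_edges_def s_def)
    moreover have "{vs ! p, vs ! (Suc p mod ?n)} \<in> cycle_edges vs"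
      using p(1) by (auto simp: cycle_edges_def)
    ultimately show "u \<in> {u. {v, u} \<in> cycle_edges vs}"
      using p(3) i(2) by (auto simp: insert_commute)
  qed
  moreover have "vs ! s \<noteq> vs ! p"
    using \<open>s \<noteq> p\<close> s p assms(1) by (simp add: nth_eq_iff_index_eq)
  ultimately show ?thesis by simp
qed

text \<open>
  Deleting a vertex \<open>y\<close> from a cycle leaves a path. Numbering the cycle from \<open>y\<close>, membership in \<open>S\<close>
  cannot change between consecutive vertices of that path.
\<close>

lemma cycle_minus_vertex_connected:
  assumes "y \<in> set vs" "S \<noteq> {}" "S \<subseteq> set vs" "y \<notin> S"
    and closed: "\<And>a b. a \<in> S \<Longrightarrow> {a, b} \<in> cycle_edges vs \<Longrightarrow> b \<in> insert y S"
    and "distinct vs"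
  shows "set vs = insert y S"
proof -
  let ?n = "length vs"
  obtain j where j: "j < ?n" "y = vs ! j"
    using assms(1) by (metis in_set_conv_nth)
  define c where "c k = vs ! ((j + k) mod ?n)" for k
  have n: "?n > 0" using j(1) by linarith
  have edge: "{c k, c (Suc k)} \<in> cycle_edges vs" for k
  proof -
    have "(j + k) mod ?n < ?n" using n by simp
    moreover have "Suc ((j + k) mod ?n) mod ?n = (j + Suc k) mod ?n"
      by (simp add: mod_Suc_eq)
    ultimately show ?thesis unfolding c_def cycle_edges_def by force
  qed
  have not_y: "c k \<noteq> y" if "0 < k" "k < ?n" for k
  proof
    assume "c k = y"
    then have "(j + k) mod ?n = j"
      using j n assms(6) by (simp add: c_def nth_eq_iff_index_eq)
    then have "(j + k) mod ?n = (j + 0) mod ?n" using j(1) by simp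
    then show False using that by (metis mod_eq_nat1E add_0 add_diff_cancel_left' add_left_mono
          dvd_imp_le dvd_triv_left leD less_imp_le_nat zero_le add.right_neutral)
  qed
  have surj: "\<exists>k<?n. v = c k" if "v \<in> set vs" for v
  proof -
    obtain i where i: "i < ?n" "v = vs ! i"
      using \<open>v \<in> set vs\<close> by (metis in_set_conv_nth)
    define k where "k = (if j \<le> i then i - j else i + ?n - j)"
    have "(j + k) mod ?n = i" "k < ?n"
      using i j by (auto simp: k_def)
    then show ?thesis using i by (auto simp: c_def)
  qed
  have c0: "c 0 = y" using j by (simp add: c_def)
  have step: "c k \<in> S \<longleftrightarrow> c (Suc k) \<in> S" if "0 < k" "Suc k < ?n" for k
    using closed[of "c k" "c (Suc k)"] closed[of "c (Suc k)" "c k"] edge[of k]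
      not_y[of k] not_y[of "Suc k"] that by (auto simp: insert_commute)
  have const: "c (Suc k) \<in> S \<longleftrightarrow> c 1 \<in> S" if "Suc k < ?n" for k
    using that
  proof (induction k)
    case (Suc k)
    then show ?case using step[of "Suc k"] by simp
  qed simp
  obtain s where s: "s \<in> S" using assms(2) by blast
  then obtain k where k: "k < ?n" "s = c k" using surj assms(3) by blast
  then have "k \<noteq> 0" using s c0 assms(4) by metis
  then have "c 1 \<in> S" using const[of "k - 1"] k s by simp
  have "v \<in> insert y S" if v: "v \<in> set vs" for v
  proof -
    obtain m where m: "m < ?n" "v = c m" using surj v by blast
    show ?thesis
    proof (cases m)
      case 0
      then show ?thesis using m c0 by simp
    next
      case (Suc m')
      then show ?thesis using m const[of m'] \<open>c 1 \<in> S\<close> by simp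
    qed
  qed
  then show ?thesis using assms(1,3) by blast
qed

section \<open>Local structure of an edge-pancyclic graph\<close>

lemma card_three_obtain:
  assumes "card A = 3" "v \<in> A" "w \<in> A" "v \<noteq> w"
  obtains x where "A = {v, w, x}" "x \<noteq> v" "x \<noteq> w"
proof -
  have fin: "finite A" using assms(1) by (metis card.infinite zero_neq_numeral)
  then have "card (A - {v, w}) = 1" using assms by (simp add: card_Diff_subset)
  then obtain x where "A - {v, w} = {x}" by (metis card_1_singletonE)
  then show thesis using that[of x] assms by blast
qed

text \<open>
  Used to read off both cycle neighbours of a vertex once two of them are known.
\<close>

lemma card_two_eq:
  assumes "card A = 2" "v \<in> A" "w \<in> A" "v \<noteq> w"
  shows "A = {v, w}"
proof -
  have "finite A" using assms(1) by (metis card.infinite zero_neq_numeral)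
  then show ?thesis using assms by (metis card_subset_eq card_2_iff empty_subsetI insert_subset)
qed

locale edge_pancyclic_graph =
  fixes V :: "'a set" and E :: "'a edge set"
  assumes simple: "simple_graph V E"
    and pancyclic: "edge_pancyclic V E"
    and nonempty: "E \<noteq> {}"
    and large: "8 \<le> card V"
begin

definition nb :: "'a \<Rightarrow> 'a set" where "nb v = {u. {v, u} \<in> E}"

definition small :: "'a set" where "small = {v \<in> V. card (nb v) = 3}"

definition big :: "'a set" where "big = V - small"

text \<open>
  A Hamilton cycle, described by its set \<open>F\<close> of edges rather than by an ordering of the vertices:
  \<open>F\<close> is 2-regular and stays connected when any one vertex \<open>y\<close> is deleted. Connectedness is expressed
  through sets \<open>S\<close> that no edge of \<open>F\<close> leaves except towards \<open>y\<close>. In this form the arguments below only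
  inspect which edges at a vertex are used.
\<close>

definition hamiltonian :: "'a edge set \<Rightarrow> bool" where
  "hamiltonian F \<longleftrightarrow> F \<subseteq> E \<and> (\<forall>v\<in>V. card {u. {v, u} \<in> F} = 2) \<and>
     (\<forall>y\<in>V. \<forall>S. S \<noteq> {} \<and> S \<subseteq> V - {y} \<and> (\<forall>a\<in>S. {u. {a, u} \<in> F} \<subseteq> insert y S) \<longrightarrow> V = insert y S)"

lemma finV: "finite V" using simple by (simp add: simple_graph_def)

lemma nb_sym: "u \<in> nb v \<longleftrightarrow> v \<in> nb u" by (simp add: nb_def insert_commute)

lemma nb_V: "nb v \<subseteq> V"
  using simple by (auto simp: nb_def simple_graph_def)

lemma nb_in_V: "u \<in> nb v \<Longrightarrow> v \<in> V"
  using nb_V nb_sym by blast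

lemma nb_irrefl: "v \<notin> nb v"
  using simple by (auto simp: nb_def simple_graph_def)

lemma nb_finite: "finite (nb v)"
  using nb_V finV finite_subset by blast

lemma cycle_of_length:
  assumes "b \<in> nb a" "3 \<le> k" "k \<le> card V"
  obtains vs where "is_cycle V E vs" "length vs = k" "{a, b} \<in> cycle_edges vs"
proof -
  have "{a, b} \<in> E" using assms(1) by (simp add: nb_def)
  then show thesis using that pancyclic assms(2,3) unfolding edge_pancyclic_def by meson
qed

lemma triangle:
  assumes "b \<in> nb a" obtains c where "c \<in> nb a" "c \<in> nb b"
proof -
  obtain vs where vs: "is_cycle V E vs" "length vs = 3" "{a, b} \<in> cycle_edges vs"
    using cycle_of_length[OF assms, of 3] large by auto
  then obtain x y z where xyz: "vs = [x, y, z]"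
    by (auto simp: numeral_eq_Suc length_Suc_conv)
  have "{x, y} \<in> E" "{y, z} \<in> E" "{z, x} \<in> E"
    using vs(1) unfolding is_cycle_def xyz cycle_edges_three by auto
  moreover have "{a, b} = {x, y} \<or> {a, b} = {y, z} \<or> {a, b} = {z, x}"
    using vs(3) unfolding xyz cycle_edges_three by auto
  ultimately have "\<exists>c. c \<in> nb a \<and> c \<in> nb b"
    unfolding nb_def by (auto simp: doubleton_eq_iff insert_commute)
  then show thesis using that by blast
qed

lemma quadrilateral:
  assumes "b \<in> nb a"
  obtains c d where "c \<in> nb b" "d \<in> nb c" "d \<in> nb a" "c \<noteq> a" "d \<noteq> b"
proof -
  obtain vs where vs: "is_cycle V E vs" "length vs = 4" "{a, b} \<in> cycle_edges vs"
    using cycle_of_length[OF assms, of 4] large by auto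
  then obtain x y z t where xyz: "vs = [x, y, z, t]"
    by (auto simp: numeral_eq_Suc length_Suc_conv)
  have "distinct [x, y, z, t]" "{x, y} \<in> E" "{y, z} \<in> E" "{z, t} \<in> E" "{t, x} \<in> E"
    using vs(1) unfolding is_cycle_def xyz cycle_edges_four by auto
  then have "distinct [x, y, z, t]" "y \<in> nb x" "z \<in> nb y" "t \<in> nb z" "x \<in> nb t"
    "x \<in> nb y" "y \<in> nb z" "z \<in> nb t" "t \<in> nb x"
    by (auto simp: nb_def insert_commute)
  moreover have "{a, b} = {x, y} \<or> {a, b} = {y, z} \<or> {a, b} = {z, t} \<or> {a, b} = {t, x}"
    using vs(3) unfolding xyz cycle_edges_four by auto
  ultimately have "\<exists>c d. c \<in> nb b \<and> d \<in> nb c \<and> d \<in> nb a \<and> c \<noteq> a \<and> d \<noteq> b"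
    unfolding doubleton_eq_iff distinct.simps list.set by (elim disjE conjE; blast)
  then show thesis using that by blast
qed

lemma hamiltonian_through:
  assumes "b \<in> nb a"
  obtains F where "hamiltonian F" "{a, b} \<in> F"
proof -
  obtain vs where vs: "is_cycle V E vs" "length vs = card V" "{a, b} \<in> cycle_edges vs"
    using cycle_of_length[OF assms, of "card V"] large by auto
  have d: "distinct vs" "set vs \<subseteq> V" "cycle_edges vs \<subseteq> E" "3 \<le> length vs"
    using vs(1) by (auto simp: is_cycle_def)
  have V: "set vs = V"
    using d vs(2) finV by (metis card_subset_eq distinct_card)
  have "hamiltonian (cycle_edges vs)"
    unfolding hamiltonian_def
  proof (intro conjI ballI allI impI)
    fix y S assume y: "y \<in> V"
      and S: "S \<noteq> {} \<and> S \<subseteq> V - {y} \<and> (\<forall>a\<in>S. {u. {a, u} \<in> cycle_edges vs} \<subseteq> insert y S)"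
    show "V = insert y S"
      using cycle_minus_vertex_connected[of y vs S] y S d(1) V by auto
  qed (use d V card_cycle_neighbours in auto)
  then show thesis using that vs(3) by blast
qed

lemma hamiltonian_exists: obtains F where "hamiltonian F"
proof -
  obtain e where "e \<in> E" using nonempty by blast
  moreover then have "card e = 2" using simple by (auto simp: simple_graph_def)
  ultimately obtain a b where "b \<in> nb a"
    unfolding nb_def by (auto simp: card_2_iff)
  then show thesis using hamiltonian_through that by blast
qed

lemma hamiltonian_minus_vertex:
  assumes "hamiltonian F" "y \<in> V" "S \<noteq> {}" "S \<subseteq> V" "y \<notin> S"
    and "\<And>a. a \<in> S \<Longrightarrow> {u. {a, u} \<in> F} \<subseteq> insert y S"
  shows "V = insert y S"
proof -
  have "S \<noteq> {} \<and> S \<subseteq> V - {y} \<and> (\<forall>a\<in>S. {u. {a, u} \<in> F} \<subseteq> insert y S)"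
    using assms(3-6) by auto
  then show ?thesis using assms(1,2) unfolding hamiltonian_def by meson
qed

text \<open>
  Some Hamilton cycle exists, and it becomes a path when \<open>y\<close> is deleted. Its edges are edges of the
  graph, so it cannot leave \<open>S\<close> except towards \<open>y\<close> either.
\<close>

lemma no_cut_vertex:
  assumes "y \<in> V" "S \<noteq> {}" "S \<subseteq> V" "y \<notin> S" "\<And>a. a \<in> S \<Longrightarrow> nb a \<subseteq> insert y S"
  shows "V = insert y S"
proof -
  obtain F where F: "hamiltonian F" using hamiltonian_exists by blast
  then have "{u. {a, u} \<in> F} \<subseteq> nb a" for a by (auto simp: hamiltonian_def nb_def)
  then show ?thesis using hamiltonian_minus_vertex[OF F assms(1-4)] assms(5) by blast
qed

text \<open>
  A closed set \<open>S\<close> remains closed when any vertex outside it is deleted, so it would contain all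
  vertices but one. The bound 6 leaves room for this with at least 8 vertices.
\<close>

lemma hamiltonian_not_closed:
  assumes "hamiltonian F" "S \<noteq> {}" "S \<subseteq> V" "card S \<le> 6"
    and "\<And>a. a \<in> S \<Longrightarrow> {u. {a, u} \<in> F} \<subseteq> S"
  shows False
proof -
  have "S \<noteq> V" using assms(4) large by auto
  then obtain y where y: "y \<in> V" "y \<notin> S" using assms(3) by blast
  then have "V = insert y S"
    using hamiltonian_minus_vertex[OF assms(1) y(1) assms(2,3) y(2)] assms(5) by blast
  moreover have "card (insert y S) \<le> Suc (card S)"
    using finite_subset[OF assms(3) finV] by (simp add: card_insert_if)
  ultimately show False using assms(4) large by auto
qed

text \<open>
  If \<open>v\<close> had only the neighbours \<open>a\<close> and \<open>b\<close>, these would be adjacent, since the edge from \<open>v\<close> to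
  \<open>a\<close> lies in a triangle. A Hamilton cycle passes through \<open>a\<close>, \<open>v\<close>, \<open>b\<close> in this order, so the edge
  between \<open>a\<close> and \<open>b\<close> would close it to a triangle.
\<close>

lemma deg_ge_3:
  assumes v: "v \<in> V"
  shows "3 \<le> card (nb v)"
proof (rule ccontr)
  assume "\<not> 3 \<le> card (nb v)"
  have sub: "{u. {v, u} \<in> F} \<subseteq> nb v" "card {u. {v, u} \<in> F} = 2" if "hamiltonian F" for F
    using that v unfolding hamiltonian_def nb_def by auto
  have eq: "nb v = {u. {v, u} \<in> F}" if "hamiltonian F" for F
    using sub[OF that] \<open>\<not> 3 \<le> card (nb v)\<close> card_seteq[OF nb_finite, of "{u. {v, u} \<in> F}" v] by simp
  obtain F0 where "hamiltonian F0" by (rule hamiltonian_exists)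
  then have "card (nb v) = 2" using eq sub(2) by metis
  then obtain a b where ab: "nb v = {a, b}" "a \<noteq> b" by (auto simp: card_2_iff)
  then obtain c where c: "c \<in> nb v" "c \<in> nb a" using triangle[of a v] by blast
  have "c \<noteq> a" using c(2) nb_irrefl by auto
  then have "b \<in> nb a" using c ab(1) by auto
  then obtain F where F: "hamiltonian F" "{a, b} \<in> F" using hamiltonian_through by blast
  define f where "f x = {u. {x, u} \<in> F}" for x
  have fv: "f v = {a, b}" using eq[OF F(1)] ab by (simp add: f_def)
  have inV: "a \<in> V" "b \<in> V" using ab nb_V by blast+
  have neq: "v \<noteq> a" "v \<noteq> b" using ab nb_irrefl by blast+
  have f2: "card (f x) = 2" if "x \<in> V" for x using F(1) that by (simp add: hamiltonian_def f_def)
  have "v \<in> f a" "v \<in> f b" "b \<in> f a" "a \<in> f b"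
    using fv F(2) by (auto simp: f_def insert_commute)
  then have "f a = {v, b}" "f b = {v, a}"
    using card_two_eq[OF f2[OF inV(1)]] card_two_eq[OF f2[OF inV(2)]] neq by blast+
  then have "x \<in> {v, a, b} \<Longrightarrow> f x \<subseteq> {v, a, b}" for x using fv by auto
  moreover have "card {v, a, b} \<le> 6" by (simp add: card_insert_if)
  ultimately show False
    using hamiltonian_not_closed[OF F(1), of "{v, a, b}"] v inV unfolding f_def by simp
qed

text \<open>
  Suppose first that the third neighbours of \<open>u\<close> and \<open>v\<close> coincide in a vertex \<open>x\<close>. The only 4-cycles
  that can contain the edge from \<open>u\<close> to \<open>v\<close> then use the edge from \<open>w\<close> to \<open>x\<close>, so this edge exists. But a
  Hamilton cycle through it must traverse \<open>u\<close> and \<open>v\<close> consecutively between \<open>w\<close> and \<open>x\<close>, so it closes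
  up on four vertices. Hence \<open>x \<noteq> y\<close>, and the triangles on the edges from \<open>u\<close> to \<open>x\<close> and from \<open>v\<close> to
  \<open>y\<close> can only have \<open>w\<close> as their third vertex.
\<close>

lemma adjacent_small:
  assumes "u \<in> small" "v \<in> small" "v \<in> nb u" "w \<in> nb u" "w \<in> nb v"
  obtains x y where "nb u = {v, w, x}" "nb v = {u, w, y}" "x \<noteq> y" "x \<in> nb w" "y \<in> nb w"
    "distinct [u, v, w, x, y]"
proof -
  have uvw: "v \<noteq> w" "u \<noteq> w" "u \<noteq> v" "u \<in> nb v" using assms nb_irrefl nb_sym by blast+
  have inV: "u \<in> V" "v \<in> V" "w \<in> V" using assms nb_in_V nb_sym by blast+
  have card3: "card (nb u) = 3" "card (nb v) = 3" using assms by (auto simp: small_def)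
  obtain x where x: "nb u = {v, w, x}" "x \<noteq> v" "x \<noteq> w"
    using card_three_obtain[OF card3(1) assms(3,4) uvw(1)] by blast
  obtain y where y: "nb v = {u, w, y}" "y \<noteq> u" "y \<noteq> w"
    using card_three_obtain[OF card3(2) uvw(4) assms(5) uvw(2)] by blast
  have xu: "x \<noteq> u" "y \<noteq> v" using x y nb_irrefl by blast+
  have xV: "x \<in> V" using x nb_V by blast
  have "x \<noteq> y"
  proof
    assume "x = y"
    obtain c d where cd: "c \<in> nb v" "d \<in> nb c" "d \<in> nb u" "c \<noteq> u" "d \<noteq> v"
      using quadrilateral[OF assms(3)] by blast
    then have "{c, d} = {w, x}" using x y \<open>x = y\<close> nb_irrefl by auto
    then have "x \<in> nb w" using cd(2) nb_sym[of x w] by (auto simp: doubleton_eq_iff)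
    then obtain F where F: "hamiltonian F" "{w, x} \<in> F" using hamiltonian_through by blast
    define f where "f z = {t. {z, t} \<in> F}" for z
    have fsym: "s \<in> f t \<longleftrightarrow> t \<in> f s" for s t by (simp add: f_def insert_commute)
    have fsub: "f z \<subseteq> nb z" for z using F(1) by (auto simp: hamiltonian_def f_def nb_def)
    have f2: "card (f z) = 2" if "z \<in> V" for z using F(1) that by (simp add: hamiltonian_def f_def)
    have wx: "x \<in> f w" "w \<in> f x" using F(2) by (auto simp: f_def insert_commute)
    \<comment> \<open>\<open>w\<close> and \<open>x\<close> already use the edge between them, so each has room for only one of \<open>u\<close>, \<open>v\<close>.\<close>
    have fw: "\<not> (u \<in> f w \<and> v \<in> f w)" "\<not> (u \<in> f x \<and> v \<in> f x)"
      using card_two_eq[OF f2[OF inV(3)]] card_two_eq[OF f2[OF xV]] wx uvw x xu by blast+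
    have two: "\<exists>p q. f z = {p, q} \<and> p \<noteq> q" if "z \<in> V" for z
      using f2[OF that] by (simp add: card_2_iff)
    have fu: "f u = {v, w} \<or> f u = {v, x} \<or> f u = {w, x}"
      using two[OF inV(1)] fsub[of u] x by auto
    have fv: "f v = {u, w} \<or> f v = {u, x} \<or> f v = {w, x}"
      using two[OF inV(2)] fsub[of v] y \<open>x = y\<close> by auto
    have cases: "f u = {v, w} \<and> f v = {u, x} \<or> f u = {v, x} \<and> f v = {u, w}"
      using fu fv fw fsym uvw x xu by (smt (verit) insert_iff singletonD)
    have "f w \<subseteq> {u, v, w, x}" "f x \<subseteq> {u, v, w, x}"
      using cases fsym card_two_eq[OF f2[OF inV(3)]] card_two_eq[OF f2[OF xV]] wx uvw x xu
      by (smt (verit) insert_iff subsetI empty_iff)+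
    then have "z \<in> {u, v, w, x} \<Longrightarrow> f z \<subseteq> {u, v, w, x}" for z using cases by auto
    moreover have "card {u, v, w, x} \<le> 6" by (simp add: card_insert_if)
    ultimately show False
      using hamiltonian_not_closed[OF F(1), of "{u, v, w, x}"] inV xV unfolding f_def by simp
  qed
  have "x \<in> nb w"
  proof -
    obtain c where c: "c \<in> nb u" "c \<in> nb x" using triangle[of x u] x by blast
    then have "c \<noteq> x" "x \<in> nb c" using nb_irrefl nb_sym[of c x] by auto
    moreover have "x \<notin> nb v" using y \<open>x \<noteq> y\<close> xu x by auto
    ultimately show ?thesis using c x by auto
  qed
  moreover have "y \<in> nb w"
  proof -
    obtain c where c: "c \<in> nb v" "c \<in> nb y" using triangle[of y v] y by blast
    then have "c \<noteq> y" "y \<in> nb c" using nb_irrefl nb_sym[of c y] by auto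
    moreover have "y \<notin> nb u" using x \<open>x \<noteq> y\<close> xu y by auto
    ultimately show ?thesis using c y by auto
  qed
  ultimately show thesis using that x y xu \<open>x \<noteq> y\<close> uvw by auto
qed

lemma common_neighbour_big:
  assumes "u \<in> small" "v \<in> small" "v \<in> nb u" "w \<in> nb u" "w \<in> nb v"
  shows "w \<in> big"
proof -
  obtain x y where xy: "nb u = {v, w, x}" "nb v = {u, w, y}" "x \<in> nb w" "y \<in> nb w"
    "distinct [u, v, w, x, y]"
    using adjacent_small[OF assms] by metis
  have "{u, v, x, y} \<subseteq> nb w" using xy assms nb_sym by blast
  then have "card {u, v, x, y} \<le> card (nb w)" using nb_finite card_mono by blast
  then have "4 \<le> card (nb w)" using xy by simp
  then show ?thesis using assms nb_V by (auto simp: big_def small_def)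
qed

text \<open>
  Each neighbour \<open>u\<close> of \<open>w\<close> is adjacent to another one, and then the third neighbour of \<open>u\<close> is
  adjacent to \<open>w\<close> too: no edge leaves the closed neighbourhood of \<open>w\<close>.
\<close>

lemma all_neighbours_small:
  assumes "w \<in> V" "nb w \<subseteq> small"
  shows "V = insert w (nb w)"
proof (rule no_cut_vertex)
  show "w \<in> V" "nb w \<subseteq> V" "w \<notin> nb w" using assms nb_V nb_irrefl by auto
  show "nb w \<noteq> {}" using deg_ge_3[OF assms(1)] by auto
  fix u assume u: "u \<in> nb w"
  then obtain v where v: "v \<in> nb w" "v \<in> nb u" using triangle by blast
  obtain x y where "nb u = {v, w, x}" "x \<in> nb w"
    using adjacent_small[of u v w] u v assms(2) nb_sym by (metis subsetD)
  then show "nb u \<subseteq> insert w (nb w)" using v(1) by auto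
qed

text \<open>
  Four small neighbours would leave only five vertices, so suppose there are three. If two of them,
  \<open>u\<close> and \<open>v\<close>, are adjacent, the neighbours of \<open>w\<close> are \<open>u\<close>, \<open>v\<close> and their third neighbours \<open>x\<close> and \<open>y\<close>;
  were \<open>x\<close> small too, \<open>y\<close> would separate \<open>u, v, w, x\<close> from the rest (\<open>end_big\<close>). If no two are adjacent,
  all three are adjacent to the fourth neighbour \<open>d\<close>. A Hamilton cycle through the edge from \<open>w\<close> to \<open>d\<close>
  leaves only one further edge at \<open>w\<close> and one at \<open>d\<close>, but each of the three needs such an edge.
\<close>

lemma deg_4_small_neighbours:
  assumes "w \<in> V" "card (nb w) = 4"
  shows "card (nb w \<inter> small) \<le> 2"
proof (rule ccontr)
  define T where "T = nb w \<inter> small"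
  assume "\<not> card (nb w \<inter> small) \<le> 2"
  then have T3: "3 \<le> card T" by (simp add: T_def)
  have T_sub: "T \<subseteq> nb w" "T \<subseteq> small" "finite T" using nb_finite by (auto simp: T_def)
  have "T \<noteq> nb w"
  proof
    assume "T = nb w"
    then have "V = insert w (nb w)" using all_neighbours_small[OF assms(1)] T_sub by blast
    then have "card V \<le> 5" using assms(2) nb_finite by (simp add: card_insert_if)
    then show False using large by simp
  qed
  then have "card T < 4" using T_sub(1) assms(2) psubset_card_mono[OF nb_finite, of T w]
    by (simp add: psubset_eq)
  then have T: "card T = 3" using T3 by simp
  have end_big: "x \<notin> small"
    if uv: "u \<in> small" "v \<in> small" "nb u = {v, w, x}" "nb v = {u, w, y}" "nb w = {u, v, x, y}"
      "distinct [u, v, w, x, y]" for u v x y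
  proof
    assume "x \<in> small"
    then have "card (nb x) = 3" by (simp add: small_def)
    moreover have "u \<in> nb x" "w \<in> nb x" "u \<noteq> w"
      using uv(3,5,6) nb_sym[of u x] nb_sym[of w x] by auto
    ultimately obtain z where z: "nb x = {u, w, z}" "z \<noteq> u" "z \<noteq> w"
      by (rule card_three_obtain)
    obtain c where c: "c \<in> nb x" "c \<in> nb z" using triangle[of z x] z by blast
    have "z \<noteq> x" using z nb_irrefl by blast
    have "z \<noteq> v" using z(1) uv(4,6) nb_sym[of x v] by auto
    have "c \<noteq> z" "z \<in> nb c" using c nb_irrefl nb_sym[of c z] by auto
    then have "z \<in> nb u \<or> z \<in> nb w" using c z by auto
    then have "z = y" using uv(3,5) z(2,3) \<open>z \<noteq> x\<close> \<open>z \<noteq> v\<close> by auto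
    have "V = insert y {u, v, w, x}"
    proof (rule no_cut_vertex)
      show "y \<in> V" "{u, v, w, x} \<subseteq> V" using uv(5) nb_V assms(1) by blast+
      show "y \<notin> {u, v, w, x}" using uv(6) by auto
      fix a assume "a \<in> {u, v, w, x}"
      then show "nb a \<subseteq> insert y {u, v, w, x}"
        using uv(3-5) z(1) unfolding \<open>z = y\<close> by (elim insertE emptyE; simp)
    qed simp
    moreover have "card (insert y {u, v, w, x}) \<le> 5" by (simp add: card_insert_if)
    ultimately show False using large by simp
  qed
  have indep: "v \<notin> nb u" if uv: "u \<in> T" "v \<in> T" for u v
  proof
    assume adj: "v \<in> nb u"
    have "u \<in> small" "v \<in> small" "w \<in> nb u" "w \<in> nb v" using uv T_sub nb_sym by blast+
    then obtain x y where xy: "nb u = {v, w, x}" "nb v = {u, w, y}" "x \<in> nb w" "y \<in> nb w"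
      "distinct [u, v, w, x, y]"
      using adjacent_small[OF _ _ adj] by metis
    have "{u, v, x, y} \<subseteq> nb w" using xy uv T_sub by blast
    moreover have "card {u, v, x, y} = 4" using xy(5) by simp
    ultimately have nbw: "nb w = {u, v, x, y}"
      using assms(2) card_subset_eq[OF nb_finite] by metis
    have "x \<notin> small" using end_big[OF \<open>u \<in> small\<close> \<open>v \<in> small\<close> xy(1,2) nbw xy(5)] .
    moreover have "y \<notin> small"
      using end_big[OF \<open>v \<in> small\<close> \<open>u \<in> small\<close> xy(2,1)] nbw xy(5) by auto
    ultimately have "T \<subseteq> {u, v}" using nbw by (auto simp: T_def)
    then have "card T \<le> card {u, v}" by (intro card_mono) auto
    then show False using T by (simp add: card_insert_if split: if_splits)
  qed
  obtain a b c where abc: "T = {a, b, c}" "a \<noteq> b" "b \<noteq> c" "a \<noteq> c"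
    using T by (auto simp: card_3_iff)
  have "card (nb w - T) = 1" using T assms(2) T_sub by (simp add: card_Diff_subset)
  then obtain d where d: "nb w - T = {d}" by (metis card_1_singletonE)
  have d_adj: "d \<in> nb t" if "t \<in> T" for t
  proof -
    obtain s where s: "s \<in> nb w" "s \<in> nb t" using triangle[of t w] \<open>t \<in> T\<close> T_sub by blast
    then have "s \<notin> T" using indep[OF \<open>t \<in> T\<close>, of s] by blast
    then have "s \<in> nb w - T" using s(1) by blast
    then show ?thesis using s(2) unfolding d by simp
  qed
  have "d \<in> nb w" "d \<notin> T" using d by blast+
  then obtain F where F: "hamiltonian F" "{w, d} \<in> F" using hamiltonian_through by blast
  define f where "f z = {t. {z, t} \<in> F}" for z
  have fsym: "s \<in> f t \<longleftrightarrow> t \<in> f s" for s t by (simp add: f_def insert_commute)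
  have fsub: "f z \<subseteq> nb z" for z using F(1) by (auto simp: hamiltonian_def f_def nb_def)
  have f2: "card (f z) = 2" if "z \<in> V" for z using F(1) that by (simp add: hamiltonian_def f_def)
  have wd: "d \<in> f w" "w \<in> f d" using F(2) by (auto simp: f_def insert_commute)
  have dV: "d \<in> V" using \<open>d \<in> nb w\<close> nb_V by blast
  \<comment> \<open>Only one of the three edges at \<open>t\<close> avoids \<open>w\<close> and \<open>d\<close>, and \<open>F\<close> uses two.\<close>
  have touch: "t \<in> f w \<or> t \<in> f d" if "t \<in> T" for t
  proof -
    have t: "t \<in> V" "card (nb t) = 3" using \<open>t \<in> T\<close> T_sub(2) by (auto simp: small_def)
    have "w \<in> nb t" "w \<noteq> d"
      using \<open>t \<in> T\<close> T_sub(1) nb_sym[of t w] \<open>d \<in> nb w\<close> nb_irrefl by auto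
    then obtain z where z: "nb t = {w, d, z}"
      using card_three_obtain[OF t(2) _ d_adj[OF \<open>t \<in> T\<close>]] by metis
    have "\<not> f t \<subseteq> {z}" using f2[OF t(1)] by (auto dest: subset_singletonD)
    then obtain s where s: "s \<in> f t" "s \<noteq> z" by blast
    then have "s \<in> {w, d}" using fsub[of t] z by auto
    then show ?thesis using s(1) fsym[of s t] by auto
  qed
  have "w \<notin> T" using T_sub nb_irrefl by blast
  have uniq: "s = t" if st: "s \<in> T" "t \<in> T" "s \<in> f w \<and> t \<in> f w \<or> s \<in> f d \<and> t \<in> f d" for s t
  proof -
    have neq: "s \<noteq> d" "t \<noteq> d" "s \<noteq> w" "t \<noteq> w" using st(1,2) \<open>d \<notin> T\<close> \<open>w \<notin> T\<close> by auto
    from st(3) show ?thesis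
    proof
      assume h: "s \<in> f w \<and> t \<in> f w"
      then have "f w = {d, s}" using card_two_eq[OF f2[OF assms(1)] wd(1)] neq by blast
      then show ?thesis using h neq by auto
    next
      assume h: "s \<in> f d \<and> t \<in> f d"
      then have "f d = {w, s}" using card_two_eq[OF f2[OF dV] wd(2)] neq by blast
      then show ?thesis using h neq by auto
    qed
  qed
  show False
    using touch[of a] touch[of b] touch[of c] uniq[of a b] uniq[of b c] uniq[of a c] abc by auto
qed

text \<open>
  The small vertices that have \<open>w\<close> as their only big neighbour. They are the inner vertices of the
  fans formed by \<open>w\<close> and the paths of small vertices among its neighbours.
\<close>

definition interior :: "'a \<Rightarrow> 'a set" where
  "interior w = {u \<in> nb w \<inter> small. nb u \<inter> big = {w}}"

text \<open>
  A small neighbour \<open>p\<close> of \<open>u\<close> shares a big common neighbour with \<open>u\<close>, and \<open>w\<close> is the only big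
  vertex available.
\<close>

lemma interior_neighbours:
  assumes "u \<in> interior w"
  shows "nb u \<subseteq> insert w (nb w \<inter> small)"
proof
  fix p assume p: "p \<in> nb u"
  have u: "u \<in> small" "nb u \<inter> big = {w}" using assms by (auto simp: interior_def)
  show "p \<in> insert w (nb w \<inter> small)"
  proof (cases "p = w")
    case False
    then have ps: "p \<in> small" using u p nb_V by (auto simp: big_def)
    obtain c where c: "c \<in> nb u" "c \<in> nb p" using triangle[OF p] by blast
    then have "c \<in> big" using common_neighbour_big[OF u(1) ps p] by blast
    then have "c = w" using u c by blast
    then show ?thesis using c ps nb_sym by blast
  qed simp
qed

lemma small_big_neighbour:
  assumes "u \<in> small"
  shows "nb u \<inter> big \<noteq> {}"
proof -
  have "card (nb u) = 3" using assms by (simp add: small_def)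
  then obtain v where v: "v \<in> nb u" by fastforce
  then obtain w where "w \<in> nb u" "w \<in> nb v" using triangle by blast
  then show ?thesis using common_neighbour_big[OF assms, of v w] v nb_V by (auto simp: big_def)
qed

text \<open>
  Write \<open>T\<close> for the small neighbours and \<open>I\<close> for the interior ones. Some neighbour of \<open>w\<close> is big, since
  the graph has more than six vertices, so \<open>T\<close> has at most four elements. The bound can then fail only
  if \<open>I\<close> has at least three elements. Since \<open>w\<close> is not a cut vertex, some edge leaves \<open>I\<close> other than
  towards \<open>w\<close>, which makes \<open>T\<close> consist of \<open>I\<close> and a single vertex \<open>e\<close>; likewise some edge leaves \<open>T\<close>,
  and it starts at \<open>e\<close>. So \<open>e\<close> has just one neighbour \<open>x\<close> in \<open>I\<close>. The other two members of \<open>I\<close> need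
  two neighbours in \<open>T\<close> other than \<open>e\<close>, so both are adjacent to \<open>x\<close>, which then has degree at least 4.
\<close>

lemma deg_5_demand:
  assumes w: "w \<in> V" "card (nb w) = 5"
  shows "card (nb w \<inter> small) + card (interior w) \<le> 6"
proof -
  define T where "T = nb w \<inter> small"
  define I where "I = interior w"
  have T: "T \<subseteq> nb w" "T \<subseteq> small" "finite T" "w \<notin> T" using nb_finite nb_irrefl by (auto simp: T_def)
  have I: "I \<subseteq> T" "finite I" using T by (auto simp: I_def interior_def T_def intro: finite_subset)
  have wI: "w \<in> nb u" "card (nb u) = 3" if "u \<in> T" for u
    using T that nb_sym by (auto simp: small_def)
  have nbI: "nb u \<subseteq> insert w T" if "u \<in> I" for u
    using interior_neighbours that by (simp add: I_def T_def)
  have not_closed: "\<not> (\<forall>u\<in>S. nb u \<subseteq> insert w S)" if "S \<noteq> {}" "S \<subseteq> nb w" for S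
  proof
    assume "\<forall>u\<in>S. nb u \<subseteq> insert w S"
    then have "V = insert w S"
      using no_cut_vertex[of w S] w(1) that nb_irrefl nb_V by blast
    then have "card V \<le> Suc (card S)"
      using that nb_finite finite_subset by (metis card_insert_if le_SucI order_refl)
    moreover have "card S \<le> 5" using that w(2) nb_finite card_mono by metis
    ultimately show False using large by simp
  qed
  have "T \<noteq> nb w"
  proof
    assume "T = nb w"
    then have "V = insert w (nb w)" using all_neighbours_small[OF w(1)] T by blast
    then have "card V \<le> 6" using w(2) nb_finite by (simp add: card_insert_if)
    then show False using large by simp
  qed
  then have cT: "card T \<le> 4"
    using T(1) w(2) psubset_card_mono[OF nb_finite, of T w] by (simp add: psubset_eq)
  have "card I \<le> 2 \<or> card I + card T \<le> 6"
  proof (rule ccontr)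
    assume "\<not> (card I \<le> 2 \<or> card I + card T \<le> 6)"
    then have cI: "3 \<le> card I" by simp
    then have "I \<noteq> {}" by auto
    then have "I \<noteq> T" using not_closed[of I] nbI I T by blast
    then have "card I < card T" using I T by (metis psubsetI psubset_card_mono)
    then have card34: "card I = 3" "card T = 4" using cI cT by auto
    then have "card (T - I) = 1" using I by (simp add: card_Diff_subset)
    then obtain e where e: "T - I = {e}" by (metis card_1_singletonE)
    then have eT: "e \<in> T" "T = insert e I" using I by auto
    then obtain z where z: "z \<in> nb e" "z \<notin> insert w T"
      using not_closed[of T] nbI T by blast
    have zw: "w \<in> nb e" "z \<noteq> w" using wI eT z by auto
    obtain r where r: "nb e = {w, z, r}"
      using card_three_obtain[OF wI(2)[OF eT(1)] zw(1) z(1)] zw(2) by metis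
    obtain x where x: "x \<in> I" "e \<in> nb x" using not_closed[of I] nbI I T \<open>I \<noteq> {}\<close> eT by blast
    then have "r = x" using r nb_sym[of e x] z I T by auto
    have "card (I - {x}) = 2" using card34 I x by simp
    then obtain y y' where yy: "I - {x} = {y, y'}" "y \<noteq> y'" by (auto simp: card_2_iff)
    have adj: "x \<in> nb s" if "s \<in> {y, y'}" for s
    proof (rule ccontr)
      assume "x \<notin> nb s"
      have s: "s \<in> I" "s \<noteq> x" using that yy by blast+
      then have "e \<notin> nb s" using r \<open>r = x\<close> nb_sym[of e s] z I T by auto
      then have "nb s \<subseteq> {w, y, y'}" using nbI[OF s(1)] eT \<open>x \<notin> nb s\<close> yy by blast
      then have "nb s \<subseteq> {w, y, y'} - {s}" using nb_irrefl by blast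
      moreover have "card ({w, y, y'} - {s}) \<le> 2" using that by (auto simp: card_insert_if)
      ultimately have "card (nb s) \<le> 2"
        by (meson card_mono finite.emptyI finite.insertI finite_Diff le_trans)
      then show False using wI(2) s I by fastforce
    qed
    have "{w, e, y, y'} \<subseteq> nb x" using adj x wI I nb_sym by blast
    then have "card {w, e, y, y'} \<le> 3" using wI(2)[of x] x I nb_finite card_mono by (metis subsetD)
    moreover have "distinct [w, e, y, y']" using yy T e I by auto
    ultimately show False by simp
  qed
  then show ?thesis using cT by (auto simp: T_def I_def)
qed

text \<open>
  A vertex of degree at least 7 can pay 2 to each neighbour, because \<open>2 d \<le> 4 d - 14\<close>. Equality
  occurs at the hub of a wheel on 8 vertices; a hub of degree 5 or 6 could not pay, and such wheels
  are excluded by the number of vertices.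
\<close>

lemma demand_bound:
  assumes "w \<in> big"
  shows "card (nb w \<inter> small) + card (interior w) + 14 \<le> 4 * card (nb w)"
proof -
  have w: "w \<in> V" "card (nb w) \<noteq> 3" using assms by (auto simp: big_def small_def)
  then have d: "4 \<le> card (nb w)" using deg_ge_3[of w] by simp
  have fin: "finite (nb w \<inter> small)" using nb_finite by simp
  have I: "interior w \<subseteq> nb w \<inter> small" by (auto simp: interior_def)
  then have i_le: "card (interior w) \<le> card (nb w \<inter> small)" using fin card_mono by blast
  have t_le: "card (nb w \<inter> small) \<le> card (nb w)" using nb_finite by (simp add: card_mono)
  consider "card (nb w) = 4" | "card (nb w) = 5" | "card (nb w) = 6" | "7 \<le> card (nb w)"
    using d by linarith
  then show ?thesis
  proof cases
    case 1
    have t2: "card (nb w \<inter> small) \<le> 2" using deg_4_small_neighbours w 1 by blast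
    have "interior w = {}"
    proof (rule ccontr)
      assume "interior w \<noteq> {}"
      then obtain u where u: "u \<in> interior w" by blast
      \<comment> \<open>An interior vertex brings two further small neighbours of \<open>w\<close> with it.\<close>
      then have "insert u (nb u - {w}) \<subseteq> nb w \<inter> small"
        using interior_neighbours[OF u] I by blast
      then have "card (insert u (nb u - {w})) \<le> card (nb w \<inter> small)" using fin card_mono by blast
      moreover have "card (insert u (nb u - {w})) = 3"
        using u nb_finite nb_irrefl nb_sym[of w u] by (auto simp: interior_def small_def)
      ultimately show False using t2 by simp
    qed
    then show ?thesis using t2 1 by simp
  next
    case 2
    then show ?thesis using deg_5_demand[of w] w by simp
  next
    case 3
    have "\<not> nb w \<subseteq> small"
    proof
      assume "nb w \<subseteq> small"
      then have "V = insert w (nb w)" using all_neighbours_small[OF w(1)] by blast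
      then have "card V \<le> 7" using 3 nb_finite by (simp add: card_insert_if)
      then show False using large by simp
    qed
    then have "card (nb w \<inter> small) < 6"
      using 3 nb_finite psubset_card_mono[of "nb w" "nb w \<inter> small"] by auto
    then show ?thesis using i_le 3 by simp
  next
    case 4
    then show ?thesis using i_le t_le by simp
  qed
qed

section \<open>The discharging argument\<close>

text \<open>
  Handshake lemma, by counting incident pairs of a vertex and an edge in two ways.
\<close>

lemma sum_degrees: "(\<Sum>v\<in>V. card (nb v)) = 2 * card E"
proof -
  have "E \<subseteq> Pow V" using simple by (auto simp: simple_graph_def)
  then have finE: "finite E" using finV finite_subset by blast
  have "card (nb v) = card {e \<in> E. v \<in> e}" for v
  proof (rule bij_betw_same_card)
    show "bij_betw (\<lambda>u. {v, u}) (nb v) {e \<in> E. v \<in> e}"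
      unfolding bij_betw_def
    proof
      show "inj_on (\<lambda>u. {v, u}) (nb v)" by (auto simp: inj_on_def doubleton_eq_iff)
      show "(\<lambda>u. {v, u}) ` nb v = {e \<in> E. v \<in> e}"
      proof (intro equalityI subsetI)
        fix e assume e: "e \<in> {e \<in> E. v \<in> e}"
        then have "card e = 2" using simple by (auto simp: simple_graph_def)
        then obtain u where "e = {v, u}" using e by (auto simp: card_2_iff)
        then show "e \<in> (\<lambda>u. {v, u}) ` nb v" using e by (auto simp: nb_def)
      qed (auto simp: nb_def)
    qed
  qed
  then have "(\<Sum>v\<in>V. card (nb v)) = (\<Sum>v\<in>V. \<Sum>e\<in>E. if v \<in> e then 1 else 0)"
    using finE by (simp add: sum.If_cases Int_def)
  also have "\<dots> = (\<Sum>e\<in>E. \<Sum>v\<in>V. if v \<in> e then 1 else 0)" by (rule sum.swap)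
  also have "\<dots> = (\<Sum>e\<in>E. 2)"
  proof (rule sum.cong)
    fix e assume "e \<in> E"
    then have "e \<subseteq> V" "card e = 2" using simple by (auto simp: simple_graph_def)
    then show "(\<Sum>v\<in>V. if v \<in> e then 1 else 0) = (2::nat)"
      using finV by (simp add: sum.If_cases Int_absorb1)
  qed simp
  finally show ?thesis by simp
qed

text \<open>
  The charge that a small \<open>u\<close> takes from a big \<open>w\<close>. The values cover the debt of 2 whatever the
  number of big neighbours of \<open>u\<close>: two of them pay 1 each, a single one pays the whole.
\<close>

definition demand :: "'a \<Rightarrow> 'a \<Rightarrow> nat" where
  "demand u w = (if w \<in> nb u then if nb u \<inter> big = {w} then 2 else 1 else 0)"

lemma demand_satisfied:
  assumes "u \<in> small"
  shows "2 \<le> (\<Sum>w\<in>big. demand u w)"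
proof -
  have fin: "finite big" using finV by (simp add: big_def)
  show ?thesis
  proof (cases "\<exists>w. nb u \<inter> big = {w}")
    case True
    then obtain w where w: "nb u \<inter> big = {w}" by blast
    then have "demand u w = 2" "w \<in> big" by (auto simp: demand_def)
    then show ?thesis using member_le_sum[of w big "demand u"] fin by simp
  next
    case False
    obtain w where "w \<in> nb u \<inter> big" using small_big_neighbour[OF assms] by blast
    then obtain w' where w: "w' \<in> nb u \<inter> big" "w \<noteq> w'" "w \<in> nb u \<inter> big"
      using False by blast
    then have "demand u w = 1" "demand u w' = 1" using False by (auto simp: demand_def)
    then have "2 = (\<Sum>z\<in>{w, w'}. demand u z)" using w by simp
    also have "\<dots> \<le> (\<Sum>z\<in>big. demand u z)" using w fin by (intro sum_mono2) auto
    finally show ?thesis .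
  qed
qed

text \<open>
  Every small neighbour of \<open>w\<close> contributes 1 to the total demand, and every interior one contributes
  1 more.
\<close>

lemma demand_affordable:
  assumes "w \<in> big"
  shows "(\<Sum>u\<in>small. demand u w) + 14 \<le> 4 * card (nb w)"
proof -
  have fin: "finite small" using finV by (simp add: small_def)
  have "demand u w = (if u \<in> nb w then 1 else 0) + (if u \<in> interior w then 1 else 0)"
    if "u \<in> small" for u
    using that nb_sym[of u w] by (auto simp: demand_def interior_def)
  then have "(\<Sum>u\<in>small. demand u w) =
      (\<Sum>u\<in>small. (if u \<in> nb w then 1 else 0) + (if u \<in> interior w then 1 else 0))"
    by (intro sum.cong) auto
  also have "\<dots> = card (small \<inter> nb w) + card (small \<inter> interior w)"
    using fin by (simp add: sum.distrib sum.If_cases Int_def)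
  also have "small \<inter> interior w = interior w" by (auto simp: interior_def)
  finally show ?thesis using demand_bound[OF assms] by (simp add: Int_commute)
qed

lemma edges_lower_bound: "7 * card V \<le> 4 * card E"
proof -
  have "small \<subseteq> V" by (auto simp: small_def)
  then have fin: "finite small" "finite big" and part: "small \<union> big = V" "small \<inter> big = {}"
    using finV finite_subset unfolding big_def by auto
  have "2 * card small = (\<Sum>u\<in>small. 2)" by simp
  also have "\<dots> \<le> (\<Sum>u\<in>small. \<Sum>w\<in>big. demand u w)" by (intro sum_mono demand_satisfied)
  also have "\<dots> = (\<Sum>w\<in>big. \<Sum>u\<in>small. demand u w)" by (rule sum.swap)
  finally have "2 * card small + 14 * card big \<le> (\<Sum>w\<in>big. (\<Sum>u\<in>small. demand u w) + 14)"
    by (simp add: sum.distrib)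
  also have "\<dots> \<le> (\<Sum>w\<in>big. 4 * card (nb w))" by (intro sum_mono demand_affordable)
  finally have big: "2 * card small + 14 * card big \<le> 4 * (\<Sum>w\<in>big. card (nb w))"
    by (simp add: sum_distrib_left)
  have "(\<Sum>v\<in>small. card (nb v)) = (\<Sum>v\<in>small. 3)"
    by (intro sum.cong) (auto simp: small_def)
  then have "2 * card E = 3 * card small + (\<Sum>w\<in>big. card (nb w))"
    using sum_degrees sum.union_disjoint[OF fin part(2), of "\<lambda>v. card (nb v)"] part(1) by simp
  moreover have "card V = card small + card big"
    using card_Un_disjoint[OF fin part(2)] part(1) by simp
  ultimately show ?thesis using big by simp
qed

end

section \<open>Wheels\<close>

definition wheel :: "nat \<Rightarrow> nat edge set" where
  "wheel m = (\<lambda>i. {m, i}) ` {..<m} \<union> (\<lambda>i. {i, Suc i mod m}) ` {..<m}"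

lemma wheel_simple: "3 \<le> m \<Longrightarrow> simple_graph {..m} (wheel m)"
  by (auto simp: simple_graph_def wheel_def mod_Suc card_insert_if)

lemma card_wheel_le: "card (wheel m) \<le> 2 * m"
proof -
  have "card (wheel m) \<le> card ((\<lambda>i. {m, i}) ` {..<m}) + card ((\<lambda>i. {i, Suc i mod m}) ` {..<m})"
    unfolding wheel_def by (rule card_Un_le)
  also have "\<dots> \<le> m + m"
    by (intro add_mono) (metis card_image_le card_lessThan finite_lessThan)+
  finally show ?thesis by simp
qed

text \<open>
  The hub \<open>m\<close> followed by \<open>l\<close> consecutive rim vertices from \<open>s\<close> on. It traverses both the spoke at \<open>s\<close>
  and the rim edge after \<open>s\<close>, so that one family of cycles serves both kinds of edges.
\<close>

definition wheel_cycle :: "nat \<Rightarrow> nat \<Rightarrow> nat \<Rightarrow> nat list" where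
  "wheel_cycle m s l = m # map (\<lambda>i. (s + i) mod m) [0..<l]"

lemma wheel_cycle_is_cycle:
  assumes "s < m" "2 \<le> l" "l \<le> m"
  shows "is_cycle {..m} (wheel m) (wheel_cycle m s l)"
    and "{m, s} \<in> cycle_edges (wheel_cycle m s l)"
    and "{s, Suc s mod m} \<in> cycle_edges (wheel_cycle m s l)"
proof -
  let ?vs = "wheel_cycle m s l"
  have m: "0 < m" using assms by simp
  have len: "length ?vs = Suc l" by (simp add: wheel_cycle_def)
  have nth0: "?vs ! 0 = m" by (simp add: wheel_cycle_def)
  have nth: "?vs ! Suc i = (s + i) mod m" if "i < l" for i using that by (simp add: wheel_cycle_def)
  have "inj_on (\<lambda>i. (s + i) mod m) {0..<l}"
  proof (rule inj_onI)
    fix i j assume ij: "i \<in> {0..<l}" "j \<in> {0..<l}" "(s + i) mod m = (s + j) mod m"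
    have "(s + k) mod m = (if s + k < m then s + k else s + k - m)" if "k < l" for k
      using that assms by (simp add: le_mod_geq)
    then show "i = j" using ij assms by (auto split: if_splits)
  qed
  moreover have "(s + i) mod m \<noteq> m" for i using m mod_less_divisor[of m "s + i"] by linarith
  ultimately have dist: "distinct ?vs"
    by (auto simp: wheel_cycle_def distinct_map dest: sym)
  have sub: "set ?vs \<subseteq> {..m}" using m by (auto simp: wheel_cycle_def less_imp_le)
  have edges: "{?vs ! i, ?vs ! (Suc i mod Suc l)} \<in> wheel m" if "i < Suc l" for i
  proof (cases i)
    case 0
    then show ?thesis using assms nth0 nth[of 0] by (auto simp: wheel_def)
  next
    case (Suc j)
    then have j: "j < l" using that by simp
    show ?thesis
    proof (cases "Suc j = l")
      case True
      then show ?thesis using Suc nth[OF j] nth0 m by (auto simp: wheel_def insert_commute)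
    next
      case False
      then have "Suc j < l" using j by simp
      then show ?thesis using Suc nth[OF j] nth[of "Suc j"] m
        by (auto simp: wheel_def mod_Suc_eq)
    qed
  qed
  then show "is_cycle {..m} (wheel m) ?vs"
    using assms len dist sub by (auto simp: is_cycle_def cycle_edges_def)
  have "{?vs ! i, ?vs ! (Suc i mod Suc l)} \<in> cycle_edges ?vs" if "i < Suc l" for i
    using that len by (auto simp: cycle_edges_def)
  from this[of 0] this[of 1]
  show "{m, s} \<in> cycle_edges ?vs" "{s, Suc s mod m} \<in> cycle_edges ?vs"
    using assms nth0 nth[of 0] nth[of 1] by auto
qed

lemma wheel_edge_pancyclic:
  assumes "3 \<le> m"
  shows "edge_pancyclic {..m} (wheel m)"
  unfolding edge_pancyclic_def
proof (intro allI impI ballI)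
  fix k e assume k: "3 \<le> k \<and> k \<le> card {..m}" and "e \<in> wheel m"
  then obtain s where s: "s < m" "e = {m, s} \<or> e = {s, Suc s mod m}" by (auto simp: wheel_def)
  moreover have "2 \<le> k - 1" "k - 1 \<le> m" "length (wheel_cycle m s (k - 1)) = k"
    using k by (auto simp: wheel_cycle_def)
  ultimately show "\<exists>vs. is_cycle {..m} (wheel m) vs \<and> length vs = k \<and> e \<in> cycle_edges vs"
    using wheel_cycle_is_cycle by metis
qed

theorem corollary1p5:
  fixes n :: nat
  assumes "n \<ge> 8"
  shows "\<lceil>7 * real n / 4\<rceil> \<le> int (min_edges_edge_pancyclic n) \<and>
         int (min_edges_edge_pancyclic n) \<le> 2 * int n - 2"
proof
  define P where "P m \<longleftrightarrow> (\<exists>(V :: nat set) E. simple_graph V E \<and> card V = n \<and> E \<noteq> {} \<and>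
    edge_pancyclic V E \<and> card E = m)" for m
  have f: "min_edges_edge_pancyclic n = (LEAST m. P m)"
    by (simp add: min_edges_edge_pancyclic_def P_def)
  have "wheel (n - 1) \<noteq> {}" using assms by (auto simp: wheel_def lessThan_empty_iff)
  then have wheel: "P (card (wheel (n - 1)))"
    unfolding P_def using wheel_simple[of "n - 1"] wheel_edge_pancyclic[of "n - 1"] assms
    by (intro exI[of _ "{..n - 1}"] exI[of _ "wheel (n - 1)"]) auto
  then have "P (LEAST m. P m)" by (rule LeastI)
  then obtain V :: "nat set" and E where G: "simple_graph V E" "card V = n" "E \<noteq> {}"
    "edge_pancyclic V E" "card E = min_edges_edge_pancyclic n"
    unfolding P_def f by blast
  then interpret edge_pancyclic_graph V E
    using assms by unfold_locales auto
  have "7 * n \<le> 4 * min_edges_edge_pancyclic n" using edges_lower_bound G by simp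
  then have "7 * real n \<le> 4 * real (min_edges_edge_pancyclic n)"
    by (metis of_nat_le_iff of_nat_mult of_nat_numeral)
  then show "\<lceil>7 * real n / 4\<rceil> \<le> int (min_edges_edge_pancyclic n)"
    by (simp add: ceiling_le_iff)
  have "min_edges_edge_pancyclic n \<le> card (wheel (n - 1))"
    unfolding f using wheel by (rule Least_le)
  also have "\<dots> \<le> 2 * (n - 1)" by (rule card_wheel_le)
  finally show "int (min_edges_edge_pancyclic n) \<le> 2 * int n - 2" using assms by simp
qed

end
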